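(* Let $\mathbf{A}$ be a finite, nontrivial solvable algebra that has a pointed cube term. Then $d_{\mathbf{A}}(n)\in\Theta(n)$. In fact, for every $n$ the algebra $\mathbf{A}^n$ is generated by those elements of $A^n$ that are constant with the possible exception of one component.
   Context: $d_{\mathbf{A}}(n)$ is the least size of a generating set of $\mathbf{A}^n$; $f\in\Theta(g)$ means there are constants $M_1,M_2,N>0$ with $M_1|g(x)|\le|f(x)|\le M_2|g(x)|$ for all $x>N$. Solvability is with respect to the term condition commutator. A pointed cube term is a term $F(x_1,\dots,x_m)$ for which there is a $k\times m$ matrix $M$ of variables and $p$ distinct constant symbols (naming elements of $A$), every column containing a symbol different from the variable $x$, such that $\mathbf{A}$ satisfies $F(M)\approx(x,\dots,x)^T$ ($F$ applied to each row of $M$ yields $x$). *)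

theory Defs
  imports Main "HOL-Library.Landau_Symbols"
begin

definition is_algebra :: "'a set \<Rightarrow> ('f \<Rightarrow> 'a list \<Rightarrow> 'a) \<Rightarrow> ('f \<Rightarrow> nat) \<Rightarrow> bool" where
  "is_algebra A ops ar \<longleftrightarrow> A \<noteq> {} \<and>
     (\<forall>f xs. length xs = ar f \<and> set xs \<subseteq> A \<longrightarrow> ops f xs \<in> A)"

datatype 'f trm = Var nat | Fun 'f "'f trm list"

fun wf_trm :: "('f \<Rightarrow> nat) \<Rightarrow> 'f trm \<Rightarrow> bool" where
  "wf_trm ar (Var v) = True"
| "wf_trm ar (Fun f ts) = (length ts = ar f \<and> (\<forall>t\<in>set ts. wf_trm ar t))"

fun trm_vars :: "'f trm \<Rightarrow> nat set" where
  "trm_vars (Var v) = {v}"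
| "trm_vars (Fun f ts) = (\<Union>t\<in>set ts. trm_vars t)"

fun eval_trm :: "('f \<Rightarrow> 'a list \<Rightarrow> 'a) \<Rightarrow> 'f trm \<Rightarrow> (nat \<Rightarrow> 'a) \<Rightarrow> 'a" where
  "eval_trm ops (Var v) env = env v"
| "eval_trm ops (Fun f ts) env = ops f (map (\<lambda>t. eval_trm ops t env) ts)"

definition is_congruence :: "'a set \<Rightarrow> ('f \<Rightarrow> 'a list \<Rightarrow> 'a) \<Rightarrow> ('f \<Rightarrow> nat) \<Rightarrow> 'a rel \<Rightarrow> bool" where
  "is_congruence A ops ar \<theta> \<longleftrightarrow> equiv A \<theta> \<and>
     (\<forall>f xs ys. length xs = ar f \<and> list_all2 (\<lambda>x y. (x, y) \<in> \<theta>) xs ys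
        \<longrightarrow> (ops f xs, ops f ys) \<in> \<theta>)"

definition centralizes :: "'a set \<Rightarrow> ('f \<Rightarrow> 'a list \<Rightarrow> 'a) \<Rightarrow> ('f \<Rightarrow> nat) \<Rightarrow>
     'a rel \<Rightarrow> 'a rel \<Rightarrow> 'a rel \<Rightarrow> bool" where
  "centralizes A ops ar \<alpha> \<beta> \<delta> \<longleftrightarrow>
     (\<forall>t n a b c d. wf_trm ar t \<longrightarrow>
        (\<forall>i<n. (a i, b i) \<in> \<alpha>) \<longrightarrow> (\<forall>i. (c i, d i) \<in> \<beta>) \<longrightarrow>
        (eval_trm ops t (\<lambda>i. if i < n then a i else c (i - n)),
         eval_trm ops t (\<lambda>i. if i < n then a i else d (i - n))) \<in> \<delta> \<longrightarrow>
        (eval_trm ops t (\<lambda>i. if i < n then b i else c (i - n)),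
         eval_trm ops t (\<lambda>i. if i < n then b i else d (i - n))) \<in> \<delta>)"

definition tc_commutator :: "'a set \<Rightarrow> ('f \<Rightarrow> 'a list \<Rightarrow> 'a) \<Rightarrow> ('f \<Rightarrow> nat) \<Rightarrow>
     'a rel \<Rightarrow> 'a rel \<Rightarrow> 'a rel" where
  "tc_commutator A ops ar \<alpha> \<beta> =
     \<Inter>{\<delta>. is_congruence A ops ar \<delta> \<and> centralizes A ops ar \<alpha> \<beta> \<delta>}"

fun derived_cong :: "'a set \<Rightarrow> ('f \<Rightarrow> 'a list \<Rightarrow> 'a) \<Rightarrow> ('f \<Rightarrow> nat) \<Rightarrow> nat \<Rightarrow> 'a rel" where
  "derived_cong A ops ar 0 = A \<times> A"
| "derived_cong A ops ar (Suc k) =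
     tc_commutator A ops ar (derived_cong A ops ar k) (derived_cong A ops ar k)"

definition solvable_alg :: "'a set \<Rightarrow> ('f \<Rightarrow> 'a list \<Rightarrow> 'a) \<Rightarrow> ('f \<Rightarrow> nat) \<Rightarrow> bool" where
  "solvable_alg A ops ar \<longleftrightarrow> (\<exists>k. derived_cong A ops ar k = Id_on A)"

text \<open>Pointed cube term. The matrix M has k rows and m columns; an entry is either
a variable (Inl v) or a constant naming an element of A (Inr a). The distinguished
variable x is variable 0.\<close>
definition has_pointed_cube_term :: "'a set \<Rightarrow> ('f \<Rightarrow> 'a list \<Rightarrow> 'a) \<Rightarrow> ('f \<Rightarrow> nat) \<Rightarrow> bool" where
  "has_pointed_cube_term A ops ar \<longleftrightarrow>
     (\<exists>(k::nat) (m::nat) (F::'f trm) (M::nat \<Rightarrow> nat \<Rightarrow> nat + 'a).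
        0 < k \<and> 0 < m \<and> wf_trm ar F \<and> trm_vars F \<subseteq> {..<m} \<and>
        (\<forall>i<k. \<forall>j<m. \<forall>a. M i j = Inr a \<longrightarrow> a \<in> A) \<and>
        (\<forall>j<m. \<exists>i<k. M i j \<noteq> Inl 0) \<and>
        (\<forall>env. (\<forall>v. env v \<in> A) \<longrightarrow>
           (\<forall>i<k. eval_trm ops F (\<lambda>j. case M i j of Inl v \<Rightarrow> env v | Inr a \<Rightarrow> a) = env 0)))"

definition power_carrier :: "'a set \<Rightarrow> nat \<Rightarrow> 'a list set" where
  "power_carrier A n = {xs. length xs = n \<and> set xs \<subseteq> A}"

inductive_set gen_sub :: "('f \<Rightarrow> 'a list \<Rightarrow> 'a) \<Rightarrow> ('f \<Rightarrow> nat) \<Rightarrow> nat \<Rightarrow> 'a list set \<Rightarrow> 'a list set"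
  for ops ar n X where
  base: "x \<in> X \<Longrightarrow> x \<in> gen_sub ops ar n X"
| step: "length vs = ar f \<Longrightarrow> (\<forall>v\<in>set vs. v \<in> gen_sub ops ar n X) \<Longrightarrow>
         map (\<lambda>i. ops f (map (\<lambda>v. v ! i) vs)) [0..<n] \<in> gen_sub ops ar n X"

definition generates_power :: "'a set \<Rightarrow> ('f \<Rightarrow> 'a list \<Rightarrow> 'a) \<Rightarrow> ('f \<Rightarrow> nat) \<Rightarrow> nat \<Rightarrow> 'a list set \<Rightarrow> bool" where
  "generates_power A ops ar n X \<longleftrightarrow>
     X \<subseteq> power_carrier A n \<and> gen_sub ops ar n X = power_carrier A n"

definition d_gen :: "'a set \<Rightarrow> ('f \<Rightarrow> 'a list \<Rightarrow> 'a) \<Rightarrow> ('f \<Rightarrow> nat) \<Rightarrow> nat \<Rightarrow> nat" where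
  "d_gen A ops ar n = (LEAST s. \<exists>X. generates_power A ops ar n X \<and> finite X \<and> card X = s)"

definition almost_constant :: "'a set \<Rightarrow> nat \<Rightarrow> 'a list set" where
  "almost_constant A n = {xs \<in> power_carrier A n. \<exists>j c. \<forall>i<n. i \<noteq> j \<longrightarrow> xs ! i = c}"

end

theory Submission
  imports Defs "HOL-Library.Countable_Set" "HOL-Library.FuncSet"
begin

text \<open>
  Let \<open>F\<close> be the cube term and \<open>S\<close> the subalgebra generated by the almost constant tuples. Going
  down the derived series one shows that every tuple \<open>a\<close> agrees with an element of \<open>S\<close> modulo the
  \<open>j\<close>-th derived congruence. For \<open>\<delta> = [\<beta>, \<beta>]\<close> the coordinates are corrected from \<open>\<beta>\<close> to \<open>\<delta>\<close>
  one at a time. Write \<open>a = F(W\<^sub>0(a), \<dots>)\<close> at the coordinate \<open>l0\<close> being corrected. If some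
  argument of \<open>F\<close>, varying in its \<open>\<beta>\<close>-class, already reaches all of the \<open>\<beta>\<close>-class of the value
  modulo \<open>\<delta>\<close>, then the correction is made by an almost constant tuple in this argument, since
  at the other coordinates one may use a row of the matrix with a constant in this column.
  Otherwise all arguments have smaller range and are corrected recursively.

  For the lower bound let \<open>\<delta> = [1, 1]\<close>. The cube term yields, for \<open>(p, q) \<notin> \<delta>\<close>, a binary
  polynomial \<open>\<psi>\<close> with \<open>\<psi>(x, x)\<close> constant modulo \<open>\<delta>\<close> and \<open>\<psi>(p, q)\<close> different from that constant.
  Hence, modulo \<open>\<delta>\<close>, terms are determined by their values at the tuples that differ from a fixed
  constant tuple in only one place, so there are at most \<open>|A|\<^bsup>(s + 1)|A|\<^esup>\<close> terms in \<open>s\<close> variables.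
  If \<open>s\<close> elements generate the \<open>n\<close>-th power, these terms must produce the \<open>2\<^sup>n\<close> tuples over \<open>{p, q}\<close>.
\<close>

text \<open>Both images are in bijection with the classes of the common kernel.\<close>

lemma card_image_eq_if_same_kernel:
  assumes "\<And>x y. x \<in> X \<Longrightarrow> y \<in> X \<Longrightarrow> g x = g y \<longleftrightarrow> h x = h y"
  shows "card (g ` X) = card (h ` X)"
proof (rule bij_betw_same_card)
  have inv: "inv_into X g (g x) \<in> X" "g (inv_into X g (g x)) = g x" if "x \<in> X" for x
    using that by (auto intro: inv_into_into f_inv_into_f)
  then have h: "h (inv_into X g (g x)) = h x" if "x \<in> X" for x
    using assms that by blast
  show "bij_betw (\<lambda>z. h (inv_into X g z)) (g ` X) (h ` X)"
    unfolding bij_betw_def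
  proof
    show "inj_on (\<lambda>z. h (inv_into X g z)) (g ` X)"
      using h assms by (auto simp: inj_on_def)
    show "(\<lambda>z. h (inv_into X g z)) ` g ` X = h ` X"
      unfolding image_image using h by (rule image_cong[OF refl])
  qed
qed

section \<open>Polynomial operations and the term condition\<close>

locale finite_algebra =
  fixes A :: "'a set" and ops :: "'f \<Rightarrow> 'a list \<Rightarrow> 'a" and ar :: "'f \<Rightarrow> nat"
  assumes algebra: "is_algebra A ops ar" and finite_carrier: "finite A"
begin

text \<open>Polynomial operations are taken as functions on infinite valuations; each depends on
  finitely many coordinates only.\<close>

inductive_set polys :: "((nat \<Rightarrow> 'a) \<Rightarrow> 'a) set" where
  proj: "(\<lambda>u. u i) \<in> polys"
| const: "c \<in> A \<Longrightarrow> (\<lambda>u. c) \<in> polys"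
| op: "length \<phi>s = ar f \<Longrightarrow> \<forall>\<phi>\<in>set \<phi>s. \<phi> \<in> polys \<Longrightarrow>
       (\<lambda>u. ops f (map (\<lambda>\<phi>. \<phi> u) \<phi>s)) \<in> polys"

definition upolys :: "('a \<Rightarrow> 'a) set" where
  "upolys = {f. (\<lambda>u. f (u 0)) \<in> polys}"

lemma ops_closed: "length xs = ar f \<Longrightarrow> set xs \<subseteq> A \<Longrightarrow> ops f xs \<in> A"
  using algebra unfolding is_algebra_def by blast

lemma polys_closed:
  assumes "\<phi> \<in> polys" "\<And>i. u i \<in> A"
  shows "\<phi> u \<in> A"
  using assms(1)
proof induction
  case (op \<phi>s f)
  then show ?case by (intro ops_closed) auto
qed (use assms(2) in auto)

lemma polys_compat:
  assumes "\<phi> \<in> polys" "is_congruence A ops ar \<beta>" "\<And>i. (u i, v i) \<in> \<beta>"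
  shows "(\<phi> u, \<phi> v) \<in> \<beta>"
  using assms(1)
proof induction
  case (const c)
  then show ?case using assms(2) unfolding is_congruence_def equiv_def refl_on_def by blast
next
  case (op \<phi>s f)
  have "list_all2 (\<lambda>x y. (x, y) \<in> \<beta>) (map (\<lambda>\<phi>. \<phi> u) \<phi>s) (map (\<lambda>\<phi>. \<phi> v) \<phi>s)"
    unfolding list_all2_conv_all_nth using op by auto
  moreover have "length (map (\<lambda>\<phi>. \<phi> u) \<phi>s) = ar f" using op by simp
  ultimately show ?case using assms(2) unfolding is_congruence_def by blast
qed (use assms(3) in auto)

lemma polys_comp:
  assumes "\<phi> \<in> polys" "\<And>i. \<psi> i \<in> polys"
  shows "(\<lambda>u. \<phi> (\<lambda>i. \<psi> i u)) \<in> polys"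
  using assms(1)
proof induction
  case (op \<phi>s f)
  have "(\<lambda>u. ops f (map (\<lambda>\<phi>. \<phi> u) (map (\<lambda>\<phi> u. \<phi> (\<lambda>i. \<psi> i u)) \<phi>s))) \<in> polys"
    by (rule polys.op) (use op in auto)
  then show ?case by (simp add: o_def)
qed (auto intro: polys.intros assms(2))

lemma eval_polys: "wf_trm ar t \<Longrightarrow> (\<lambda>u. eval_trm ops t u) \<in> polys"
proof (induction t)
  case (Fun f ts)
  have "(\<lambda>u. ops f (map (\<lambda>\<phi>. \<phi> u) (map (eval_trm ops) ts))) \<in> polys"
    by (rule polys.op) (use Fun in auto)
  then show ?case by (simp add: o_def)
next
  case (Var v)
  have "(\<lambda>u. eval_trm ops (Var v) u) = (\<lambda>u. u v)" by auto
  then show ?case using polys.proj by metis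
qed

lemma upolys_id: "(\<lambda>x. x) \<in> upolys"
  unfolding upolys_def by (auto intro: polys.proj)

lemma upolys_poly: "f \<in> upolys \<Longrightarrow> \<phi> \<in> polys \<Longrightarrow> (\<lambda>u. f (\<phi> u)) \<in> polys"
  unfolding upolys_def using polys_comp[of "\<lambda>u. f (u 0)" "\<lambda>_. \<phi>"] by simp

lemma upolys_closed: "f \<in> upolys \<Longrightarrow> x \<in> A \<Longrightarrow> f x \<in> A"
  unfolding upolys_def using polys_closed[of "\<lambda>u. f (u 0)" "\<lambda>_. x"] by simp

lemma upolys_section:
  assumes "\<phi> \<in> polys" "\<And>i. w i \<in> A"
  shows "(\<lambda>x. \<phi> (w(j := x))) \<in> upolys"
proof -
  define \<psi> :: "nat \<Rightarrow> (nat \<Rightarrow> 'a) \<Rightarrow> 'a"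
    where "\<psi> i = (if i = j then (\<lambda>u. u 0) else (\<lambda>u. w i))" for i
  have "\<psi> i \<in> polys" for i
    unfolding \<psi>_def using assms(2) polys.proj polys.const by auto
  then have "(\<lambda>u. \<phi> (\<lambda>i. \<psi> i u)) \<in> polys"
    by (rule polys_comp[OF assms(1)])
  moreover have "(\<lambda>i. \<psi> i u) = w(j := u 0)" for u
    unfolding \<psi>_def by auto
  ultimately show ?thesis unfolding upolys_def by simp
qed

text \<open>The definition of \<^const>\<open>centralizes\<close> puts the first block of variables at the indices
  below \<open>n\<close>. The variables outside \<open>I\<close> are moved to the even and the constants to
  the odd positions of the second block.\<close>

lemma centralizes_polys:
  assumes "centralizes A ops ar \<alpha> \<beta> \<delta>" "equiv A \<alpha>" "equiv A \<beta>" "finite I" "\<phi> \<in> polys"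
    and "\<And>i. i \<in> I \<Longrightarrow> (a i, b i) \<in> \<alpha>" "\<And>i. i \<notin> I \<Longrightarrow> (c i, d i) \<in> \<beta>"
    and "(\<phi> (\<lambda>i. if i \<in> I then a i else c i), \<phi> (\<lambda>i. if i \<in> I then a i else d i)) \<in> \<delta>"
  shows "(\<phi> (\<lambda>i. if i \<in> I then b i else c i), \<phi> (\<lambda>i. if i \<in> I then b i else d i)) \<in> \<delta>"
proof -
  obtain n where n: "\<And>i. i \<in> I \<Longrightarrow> i < n"
    using finite_nat_set_iff_bounded[of I] assms(4) by auto
  have "A \<noteq> {}" using algebra unfolding is_algebra_def by blast
  \<comment> \<open>A constant becomes a variable with the same value on both sides, so reflexivity
    relates it to itself. The enumeration of \<open>A\<close> provides such a variable for every
    constant; vacant positions hold \<open>e 0\<close>.\<close>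
  then obtain e :: "nat \<Rightarrow> 'a" where e: "range e = A"
    using countable_finite[OF finite_carrier] by (metis range_from_nat_into)
  define env where "env u v = (if v < n then (if v \<in> I then u v else e 0)
      else if even (v - n) then (if (v - n) div 2 \<in> I then e 0 else u ((v - n) div 2))
      else e ((v - n) div 2))" for u v
  have "\<exists>t. wf_trm ar t \<and> (\<forall>u. \<phi> u = eval_trm ops t (env u))"
    using assms(5)
  proof induction
    case (proj i)
    show ?case
    proof (cases "i \<in> I")
      case True
      then show ?thesis by (intro exI[of _ "Var i"]) (auto simp: env_def n)
    next
      case False
      then show ?thesis by (intro exI[of _ "Var (n + 2 * i)"]) (auto simp: env_def)
    qed
  next
    case (const c)
    then obtain k where "e k = c" using e by auto
    then show ?case by (intro exI[of _ "Var (n + 2 * k + 1)"]) (auto simp: env_def)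
  next
    case (op \<phi>s f)
    then obtain T where T: "\<And>\<phi>. \<phi> \<in> set \<phi>s \<Longrightarrow> wf_trm ar (T \<phi>) \<and> (\<forall>u. \<phi> u = eval_trm ops (T \<phi>) (env u))"
      by metis
    have "map (\<lambda>\<phi>. \<phi> u) \<phi>s = map (\<lambda>\<phi>. eval_trm ops (T \<phi>) (env u)) \<phi>s" for u
      by (intro map_cong refl) (use T in blast)
    moreover have "wf_trm ar (Fun f (map T \<phi>s))" using T op by auto
    ultimately show ?case
      by (intro exI[of _ "Fun f (map T \<phi>s)"] conjI) (auto simp only: eval_trm.simps map_map o_def)
  qed
  then obtain t where t: "wf_trm ar t" "\<And>u. \<phi> u = eval_trm ops t (env u)" by blast
  define blk where "blk g i = (if i \<in> I then g i else e 0)" for g i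
  define off where "off g w = (if even w then (if w div 2 \<in> I then e 0 else g (w div 2))
      else e (w div 2))" for g and w :: nat
  have env: "env (\<lambda>i. if i \<in> I then g i else h i) = (\<lambda>i. if i < n then blk g i else off h (i - n))"
    for g h
    by (auto simp: env_def blk_def off_def fun_eq_iff)
  have eA: "e i \<in> A" for i using e by blast
  have "(blk a i, blk b i) \<in> \<alpha>" for i
    using assms(2,6) eA unfolding blk_def equiv_def refl_on_def by auto
  moreover have "(off c i, off d i) \<in> \<beta>" for i
    using assms(3,7) eA unfolding off_def equiv_def refl_on_def by auto
  ultimately show ?thesis
    using assms(1,8) t(1) unfolding t(2) env centralizes_def by blast
qed

text \<open>The coordinates below \<open>m\<close> other than \<open>j\<close> form the first block;
  in the second block only \<open>j\<close> changes, from \<open>x\<close> to \<open>y\<close>. The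
  bound \<open>m\<close> keeps the first block finite.\<close>

lemma centralizes_section:
  assumes "centralizes A ops ar \<beta> \<beta> \<delta>" "equiv A \<beta>" "\<phi> \<in> polys"
    and "\<And>i. (u i, v i) \<in> \<beta>" "\<And>i. m \<le> i \<Longrightarrow> u i = v i" "(x, y) \<in> \<beta>"
    and "(\<phi> (u(j := x)), \<phi> (u(j := y))) \<in> \<delta>"
  shows "(\<phi> (v(j := x)), \<phi> (v(j := y))) \<in> \<delta>"
proof -
  let ?I = "{..<m} - {j}"
  have u: "(\<lambda>i. if i \<in> ?I then u i else (u(j := z)) i) = u(j := z)"
    and v: "(\<lambda>i. if i \<in> ?I then v i else (u(j := z)) i) = v(j := z)" for z
    using assms(5) by (auto simp: fun_eq_iff)
  have "u i \<in> A" for i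
    using assms(2,4) by (meson equiv_class_eq_iff)
  then have "((u(j := x)) i, (u(j := y)) i) \<in> \<beta>" for i
    using assms(2,6) unfolding equiv_def refl_on_def by auto
  then show ?thesis
    using centralizes_polys[OF assms(1,2,2) _ assms(3),
        where I = ?I and a = u and b = v and c = "u(j := x)" and d = "u(j := y)"] assms(4,7)
    unfolding u v by blast
qed


lemma centralizes_section_iff:
  assumes "centralizes A ops ar \<beta> \<beta> \<delta>" "equiv A \<beta>" "\<phi> \<in> polys"
    and "\<And>i. (u i, v i) \<in> \<beta>" "\<And>i. m \<le> i \<Longrightarrow> u i = v i" "(x, y) \<in> \<beta>"
  shows "(\<phi> (u(j := x)), \<phi> (u(j := y))) \<in> \<delta> \<longleftrightarrow> (\<phi> (v(j := x)), \<phi> (v(j := y))) \<in> \<delta>"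
proof
  assume "(\<phi> (u(j := x)), \<phi> (u(j := y))) \<in> \<delta>"
  then show "(\<phi> (v(j := x)), \<phi> (v(j := y))) \<in> \<delta>"
    using assms by (intro centralizes_section[of _ _ _ u v m])
next
  have "(v i, u i) \<in> \<beta>" for i
    using assms(2,4) by (meson equivE symE)
  moreover assume "(\<phi> (v(j := x)), \<phi> (v(j := y))) \<in> \<delta>"
  ultimately show "(\<phi> (u(j := x)), \<phi> (u(j := y))) \<in> \<delta>"
    using centralizes_section[of \<beta> \<delta> \<phi> v u m x y j] assms by metis
qed

section \<open>The commutator and the derived series\<close>

lemma congruence_full: "is_congruence A ops ar (A \<times> A)"
proof -
  have "equiv A (A \<times> A)"
    by (auto intro!: equivI refl_onI symI transI)
  moreover have "(ops f xs, ops f ys) \<in> A \<times> A"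
    if "length xs = ar f" "list_all2 (\<lambda>x y. (x, y) \<in> A \<times> A) xs ys" for f xs ys
    using that by (auto intro!: ops_closed simp: list_all2_conv_all_nth in_set_conv_nth)
  ultimately show ?thesis unfolding is_congruence_def by blast
qed

text \<open>Puts \<open>A \<times> A\<close> into the family whose intersection is the commutator,
  so that this intersection is a relation on \<open>A\<close>.\<close>

lemma centralizes_full:
  assumes "equiv A \<alpha>" "equiv A \<beta>"
  shows "centralizes A ops ar \<alpha> \<beta> (A \<times> A)"
  unfolding centralizes_def
proof (intro allI impI SigmaI)
  fix t n and a b c d :: "nat \<Rightarrow> 'a"
  assume t: "wf_trm ar t" and ab: "\<forall>i<n. (a i, b i) \<in> \<alpha>" and cd: "\<forall>i. (c i, d i) \<in> \<beta>"
  have A: "b i \<in> A" if "i < n" for i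
    using ab assms(1) that by (meson equiv_class_eq_iff)
  have "c i \<in> A" "d i \<in> A" for i
    using cd assms(2) by (meson equiv_class_eq_iff)+
  then show "eval_trm ops t (\<lambda>i. if i < n then b i else c (i - n)) \<in> A"
    "eval_trm ops t (\<lambda>i. if i < n then b i else d (i - n)) \<in> A"
    using A by (auto intro!: polys_closed[OF eval_polys[OF t]])
qed

text \<open>Puts \<beta> into the family that defines its own commutator, so the derived series
  descends.\<close>

lemma centralizes_self:
  assumes "is_congruence A ops ar \<beta>"
  shows "centralizes A ops ar \<beta> \<beta> \<beta>"
  unfolding centralizes_def
proof (intro allI impI)
  fix t n and a b c d :: "nat \<Rightarrow> 'a"
  assume t: "wf_trm ar t" and ab: "\<forall>i<n. (a i, b i) \<in> \<beta>" and cd: "\<forall>i. (c i, d i) \<in> \<beta>"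
  have "equiv A \<beta>" using assms unfolding is_congruence_def by blast
  then have "(b i, b i) \<in> \<beta>" if "i < n" for i
    using ab that by (meson equivE symE transE)
  then show "(eval_trm ops t (\<lambda>i. if i < n then b i else c (i - n)),
      eval_trm ops t (\<lambda>i. if i < n then b i else d (i - n))) \<in> \<beta>"
    using cd by (intro polys_compat[OF eval_polys[OF t] assms]) auto
qed

text \<open>For fixed \<beta>, compatibility and the term condition both pass from the members of a
  family of congruences to their intersection.\<close>

lemma commutator_props:
  assumes "is_congruence A ops ar \<beta>"
  shows "is_congruence A ops ar (tc_commutator A ops ar \<beta> \<beta>)"
    and "centralizes A ops ar \<beta> \<beta> (tc_commutator A ops ar \<beta> \<beta>)"
    and "tc_commutator A ops ar \<beta> \<beta> \<subseteq> \<beta>"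
proof -
  have eq: "equiv A \<beta>" using assms unfolding is_congruence_def by blast
  define D where "D = {\<delta>. is_congruence A ops ar \<delta> \<and> centralizes A ops ar \<beta> \<beta> \<delta>}"
  have D: "tc_commutator A ops ar \<beta> \<beta> = \<Inter>D" unfolding tc_commutator_def D_def ..
  have full: "A \<times> A \<in> D"
    unfolding D_def using congruence_full centralizes_full[OF eq eq] by simp
  have eqD: "equiv A \<delta>" if "\<delta> \<in> D" for \<delta>
    using that unfolding D_def is_congruence_def by blast
  have "equiv A (\<Inter>D)"
  proof (rule equivI)
    show "\<Inter>D \<subseteq> A \<times> A" using full by blast
    show "refl_on A (\<Inter>D)" using eqD unfolding equiv_def refl_on_def by blast
    show "sym (\<Inter>D)" using eqD unfolding equiv_def sym_def by blast
    show "trans (\<Inter>D)" using eqD unfolding equiv_def trans_def by blast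
  qed
  moreover have "(ops f xs, ops f ys) \<in> \<Inter>D"
    if "length xs = ar f" "list_all2 (\<lambda>x y. (x, y) \<in> \<Inter>D) xs ys" for f xs ys
  proof
    fix \<delta> assume \<delta>: "\<delta> \<in> D"
    then have "list_all2 (\<lambda>x y. (x, y) \<in> \<delta>) xs ys"
      using that(2) by (auto simp: list_all2_conv_all_nth)
    then show "(ops f xs, ops f ys) \<in> \<delta>"
      using \<delta> that(1) unfolding D_def is_congruence_def by blast
  qed
  ultimately show "is_congruence A ops ar (tc_commutator A ops ar \<beta> \<beta>)"
    unfolding is_congruence_def D by blast
  show "centralizes A ops ar \<beta> \<beta> (tc_commutator A ops ar \<beta> \<beta>)"
    unfolding centralizes_def
  proof (intro allI impI)
    fix t n and a b c d :: "nat \<Rightarrow> 'a"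
    assume *: "wf_trm ar t" "\<forall>i<n. (a i, b i) \<in> \<beta>" "\<forall>i. (c i, d i) \<in> \<beta>"
      "(eval_trm ops t (\<lambda>i. if i < n then a i else c (i - n)),
         eval_trm ops t (\<lambda>i. if i < n then a i else d (i - n))) \<in> tc_commutator A ops ar \<beta> \<beta>"
    show "(eval_trm ops t (\<lambda>i. if i < n then b i else c (i - n)),
         eval_trm ops t (\<lambda>i. if i < n then b i else d (i - n))) \<in> tc_commutator A ops ar \<beta> \<beta>"
      unfolding D
    proof
      fix \<delta> assume "\<delta> \<in> D"
      then have "centralizes A ops ar \<beta> \<beta> \<delta>" "(eval_trm ops t (\<lambda>i. if i < n then a i else c (i - n)),
         eval_trm ops t (\<lambda>i. if i < n then a i else d (i - n))) \<in> \<delta>"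
        using *(4) unfolding D unfolding D_def by auto
      then show "(eval_trm ops t (\<lambda>i. if i < n then b i else c (i - n)),
         eval_trm ops t (\<lambda>i. if i < n then b i else d (i - n))) \<in> \<delta>"
        using *(1-3) unfolding centralizes_def by blast
    qed
  qed
  show "tc_commutator A ops ar \<beta> \<beta> \<subseteq> \<beta>"
    unfolding D using centralizes_self[OF assms] assms unfolding D_def by blast
qed

lemma derived_congruence: "is_congruence A ops ar (derived_cong A ops ar j)"
  by (induction j) (simp_all add: congruence_full commutator_props)

lemma gen_sub_closed:
  assumes "X \<subseteq> power_carrier A n"
  shows "gen_sub ops ar n X \<subseteq> power_carrier A n"
proof
  fix v assume "v \<in> gen_sub ops ar n X"
  then show "v \<in> power_carrier A n"
  proof induction
    case (step vs f)
    have "ops f (map (\<lambda>v. v ! l) vs) \<in> A" if "l < n" for l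
      using step that unfolding power_carrier_def by (intro ops_closed) fastforce+
    then show ?case unfolding power_carrier_def by auto
  qed (use assms in auto)
qed

text \<open>Two of the first \<open>card A + 1\<close> iterates coincide, and cancelling modulo
  \<delta> gives a period of at most \<open>card A\<close>, which divides the factorial. One
  exponent serves all such maps, so inversion can be done uniformly in a parameter.\<close>

lemma iterate_fact_card:
  assumes "equiv A \<delta>" "\<And>x. x \<in> A \<Longrightarrow> h x \<in> A" "x \<in> A"
    and "\<And>x y. x \<in> A \<Longrightarrow> y \<in> A \<Longrightarrow> (h x, h y) \<in> \<delta> \<longleftrightarrow> (x, y) \<in> \<delta>"
  shows "((h ^^ fact (card A)) x, x) \<in> \<delta>"
proof -
  have closed: "(h ^^ i) y \<in> A" if "y \<in> A" for i y
    using that by (induction i) (auto intro: assms(2))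
  have ker: "((h ^^ i) y, (h ^^ i) z) \<in> \<delta> \<longleftrightarrow> (y, z) \<in> \<delta>" if "y \<in> A" "z \<in> A" for i y z
    using that by (induction i) (auto simp: assms(4) closed)
  have "\<not> inj_on (\<lambda>i. (h ^^ i) x) {..card A}"
  proof
    assume "inj_on (\<lambda>i. (h ^^ i) x) {..card A}"
    moreover have "(\<lambda>i. (h ^^ i) x) ` {..card A} \<subseteq> A" using closed[OF assms(3)] by auto
    ultimately have "card {..card A} \<le> card A" using finite_carrier by (rule card_inj_on_le)
    then show False by simp
  qed
  then obtain i j where ij: "i < j" "j \<le> card A" "(h ^^ i) x = (h ^^ j) x"
    unfolding inj_on_def by (metis atMost_iff nat_neq_iff)
  define d where "d = j - i"
  have "(h ^^ j) x = (h ^^ i) ((h ^^ d) x)"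
    using ij(1) by (simp add: d_def flip: funpow_add[unfolded fun_eq_iff o_def, rule_format])
  then have "((h ^^ i) ((h ^^ d) x), (h ^^ i) x) \<in> \<delta>"
    using ij(3) closed[OF assms(3)] assms(1) unfolding equiv_def refl_on_def by metis
  then have d: "((h ^^ d) x, x) \<in> \<delta>" using ker closed assms(3) by blast
  have mult: "((h ^^ (d * r)) x, x) \<in> \<delta>" for r
  proof (induction r)
    case 0
    then show ?case using assms(1,3) unfolding equiv_def refl_on_def by simp
  next
    case (Suc r)
    then have "((h ^^ d) ((h ^^ (d * r)) x), (h ^^ d) x) \<in> \<delta>"
      using ker closed assms(3) by blast
    then have "((h ^^ d) ((h ^^ (d * r)) x), x) \<in> \<delta>"
      using d assms(1) by (meson equivE transD)
    then show ?case by (simp add: funpow_add)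
  qed
  have "1 \<le> d" "d \<le> card A" unfolding d_def using ij by auto
  then have "d dvd fact (card A)" by (rule dvd_fact)
  then show ?thesis using mult by (metis dvd_def)
qed

text \<open>Induction measure for the correction of one coordinate from \<open>\<beta>\<close> to \<open>\<delta>\<close>.\<close>

definition rank :: "'a rel \<Rightarrow> 'a rel \<Rightarrow> ('a \<Rightarrow> 'a) \<Rightarrow> 'a \<Rightarrow> nat" where
  "rank \<beta> \<delta> f x = card ((\<lambda>y. \<delta> `` {f y}) ` (\<beta> `` {x}))"

end

section \<open>Generation of the powers by almost constant tuples\<close>

lemma eval_trm_cong:
  "(\<And>v. v \<in> trm_vars t \<Longrightarrow> env v = env' v) \<Longrightarrow> eval_trm ops t env = eval_trm ops t env'"
proof (induction t)
  case (Fun f ts)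
  then have "map (\<lambda>t. eval_trm ops t env) ts = map (\<lambda>t. eval_trm ops t env') ts"
    by auto
  then show ?case by (simp only: eval_trm.simps)
qed simp

lemma gen_sub_eval_trm:
  assumes "wf_trm ar t" "\<And>v. map (s v) [0..<n] \<in> gen_sub ops ar n X"
  shows "map (\<lambda>l. eval_trm ops t (\<lambda>v. s v l)) [0..<n] \<in> gen_sub ops ar n X"
  using assms(1)
proof (induction t)
  case (Var v)
  then show ?case using assms(2) by simp
next
  case (Fun f ts)
  let ?vs = "map (\<lambda>t. map (\<lambda>l. eval_trm ops t (\<lambda>v. s v l)) [0..<n]) ts"
  have "map (\<lambda>l. ops f (map (\<lambda>v. v ! l) ?vs)) [0..<n] \<in> gen_sub ops ar n X"
    by (rule gen_sub.step) (use Fun in auto)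
  also have "map (\<lambda>l. ops f (map (\<lambda>v. v ! l) ?vs)) [0..<n]
      = map (\<lambda>l. eval_trm ops (Fun f ts) (\<lambda>v. s v l)) [0..<n]"
    by (simp add: o_def)
  finally show ?case .
qed

lemma almost_constant_upd:
  "c \<in> A \<Longrightarrow> y \<in> A \<Longrightarrow> map ((\<lambda>_. c)(l := y)) [0..<n] \<in> almost_constant A n"
  unfolding almost_constant_def power_carrier_def by (auto intro!: exI[of _ l] exI[of _ c])

text \<open>\<open>W i x\<close> is the \<open>i\<close>-th row of the matrix, with all variables other than \<open>x\<close> specialised
  to a fixed element \<open>e\<close>.\<close>

locale cube_algebra = finite_algebra A ops ar
  for A :: "'a set" and ops :: "'f \<Rightarrow> 'a list \<Rightarrow> 'a" and ar :: "'f \<Rightarrow> nat" +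
  fixes k m :: nat and F :: "'f trm" and e :: 'a and W :: "nat \<Rightarrow> 'a \<Rightarrow> nat \<Rightarrow> 'a"
  assumes k: "0 < k" and F: "wf_trm ar F" and e: "e \<in> A"
    and cube: "\<And>i x. i < k \<Longrightarrow> x \<in> A \<Longrightarrow> eval_trm ops F (W i x) = x"
    and row_entry: "\<And>i j. i < k \<Longrightarrow> (\<forall>x. W i x j = x) \<or> (\<exists>c\<in>A. \<forall>x. W i x j = c)"
    and row_tail: "\<And>i j x. m \<le> j \<Longrightarrow> W i x j = e"
    and column: "\<And>j. \<exists>i<k. \<exists>c\<in>A. \<forall>x. W i x j = c"
begin

definition \<phi> :: "(nat \<Rightarrow> 'a) \<Rightarrow> 'a" where "\<phi> = eval_trm ops F"

lemma phi_polys: "\<phi> \<in> polys"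
  unfolding \<phi>_def by (rule eval_polys[OF F])

lemma phi_W: "i < k \<Longrightarrow> x \<in> A \<Longrightarrow> \<phi> (W i x) = x"
  unfolding \<phi>_def by (rule cube)

lemma W_closed: "i < k \<Longrightarrow> x \<in> A \<Longrightarrow> W i x j \<in> A"
  using row_entry[of i j] by auto

text \<open>The polynomial \<open>f\<close> is there for the recursion: an argument of \<phi> only
  has to be right after passing through \<open>g j\<close>, which is a claim of the same form. The
  rank counts the \<delta>-classes that \<open>f\<close> meets on the \<beta>-class of
  \<open>a l0\<close>.\<close>

lemma extend_coordinate:
  fixes S :: "(nat \<Rightarrow> 'a) set"
  assumes cong: "is_congruence A ops ar \<beta>" "is_congruence A ops ar \<delta>"
    and cen: "centralizes A ops ar \<beta> \<beta> \<delta>"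
    and almost: "\<And>c y l. c \<in> A \<Longrightarrow> y \<in> A \<Longrightarrow> (\<lambda>_. c)(l := y) \<in> S"
    and clos: "\<And>s. (\<And>j. s j \<in> S) \<Longrightarrow> (\<lambda>l. \<phi> (\<lambda>j. s j l)) \<in> S"
    and IH: "\<And>a. (\<And>l. a l \<in> A) \<Longrightarrow> \<exists>s\<in>S. (\<forall>l\<in>L. (s l, a l) \<in> \<beta>) \<and> (\<forall>l\<in>I. (s l, a l) \<in> \<delta>)"
    and I: "l0 \<notin> I" "l0 \<in> L"
    and "f \<in> upolys" "\<And>l. a l \<in> A"
  shows "\<exists>s\<in>S. (\<forall>l\<in>L. (s l, a l) \<in> \<beta>) \<and> (\<forall>l\<in>I. (s l, a l) \<in> \<delta>) \<and> (f (s l0), f (a l0)) \<in> \<delta>"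
  using assms(9-)
proof (induction "rank \<beta> \<delta> f (a l0)" arbitrary: f a rule: less_induct)
  case less
  note f = \<open>f \<in> upolys\<close> and a = \<open>\<And>l. a l \<in> A\<close>
  have equiv: "equiv A \<beta>" "equiv A \<delta>" using cong unfolding is_congruence_def by auto
  have A: "x \<in> A" "y \<in> A" if "(x, y) \<in> \<beta>" for x y
    using equiv(1) that by (meson equiv_class_eq_iff)+
  have refl: "(x, x) \<in> \<beta>" "(x, x) \<in> \<delta>" if "x \<in> A" for x
    using equiv that unfolding equiv_def refl_on_def by auto
  have trans: "(x, z) \<in> \<delta>" if "(x, y) \<in> \<delta>" "(y, z) \<in> \<delta>" for x y z
    using equiv(2) that by (meson equivE transD)
  have const_e: "(\<lambda>_. e) \<in> S" using almost[OF e e, of 0] by (simp add: fun_upd_idem)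
  define w where "w = W 0 (a l0)"
  have w: "w j \<in> A" for j unfolding w_def using W_closed[OF k] a by blast
  have w_tail: "w j = e" if "m \<le> j" for j unfolding w_def using row_tail that by blast
  have phi_w: "\<phi> w = a l0" unfolding w_def using phi_W[OF k] a by blast
  have fphi: "(\<lambda>u. f (\<phi> u)) \<in> polys" using f phi_polys by (rule upolys_poly)
  define g where "g j x = f (\<phi> (w(j := x)))" for j x
  have g: "g j \<in> upolys" for j
    unfolding g_def using upolys_section[OF fphi w] .
  let ?im = "\<lambda>h x. (\<lambda>y. \<delta> `` {h y}) ` (\<beta> `` {x})"
  have fin: "finite (?im h x)" for h x
    using equiv(1) finite_carrier by (intro finite_imageI finite_subset[of "\<beta> `` {x}" A]) (auto dest: A)
  \<comment> \<open>\<phi> respects \<beta>, so varying argument \<open>j\<close> in its class keeps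
    the value of \<phi> in the class of \<open>a l0\<close>. This is used for \<open>w\<close> and
    later for its approximation \<open>p\<close>.\<close>
  have sub: "?im (\<lambda>y. f (\<phi> (p(j := y)))) (w j) \<subseteq> ?im f (a l0)" if "\<And>i. (p i, w i) \<in> \<beta>" for p j
  proof -
    have "(\<phi> w, \<phi> (p(j := y))) \<in> \<beta>" if "(w j, y) \<in> \<beta>" for y
      using that \<open>\<And>i. (p i, w i) \<in> \<beta>\<close> equiv(1)
      by (intro polys_compat[OF phi_polys cong(1)]) (auto simp: equiv_def sym_def)
    then show ?thesis unfolding phi_w by auto
  qed
  have le: "rank \<beta> \<delta> (g j) (w j) \<le> rank \<beta> \<delta> f (a l0)" for j
    unfolding rank_def g_def using sub[of w j] refl w fin by (intro card_mono) auto
  show ?case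
  proof (cases "\<exists>j. rank \<beta> \<delta> (g j) (w j) = rank \<beta> \<delta> f (a l0)")
    case True
    then obtain j where j: "rank \<beta> \<delta> (g j) (w j) = rank \<beta> \<delta> f (a l0)" by blast
    obtain i c where i: "i < k" "c \<in> A" "\<And>x. W i x j = c" using column[of j] by blast
    text \<open>Row \<open>0\<close> at \<open>l0\<close>, row \<open>i\<close> everywhere else.\<close>
    define b where "b j' l = (if l = l0 then w j' else W i (a l) j')" for j' l
    have b: "b j' l \<in> A" for j' l unfolding b_def using w W_closed[OF i(1)] a by simp
    \<comment> \<open>The clause for \<open>m \<le> j'\<close> makes \<open>p\<close> and
      \<open>w\<close> agree from \<open>m\<close> on, as the term condition requires.\<close>
    have "\<exists>s\<in>S. (\<forall>l\<in>L. (s l, b j' l) \<in> \<beta>) \<and> (\<forall>l\<in>I. (s l, b j' l) \<in> \<delta>) \<and> (m \<le> j' \<longrightarrow> s = (\<lambda>_. e))" for j'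
    proof (cases "m \<le> j'")
      case True
      then have "b j' l = e" for l unfolding b_def using w_tail row_tail by simp
      then show ?thesis using const_e refl[OF e] by (intro bexI[of _ "\<lambda>_. e"]) auto
    next
      case False
      then show ?thesis using IH[of "b j'"] b by auto
    qed
    then obtain s where s: "\<And>j'. s j' \<in> S" "\<And>j' l. l \<in> L \<Longrightarrow> (s j' l, b j' l) \<in> \<beta>"
      "\<And>j' l. l \<in> I \<Longrightarrow> (s j' l, b j' l) \<in> \<delta>" "\<And>j'. m \<le> j' \<Longrightarrow> s j' = (\<lambda>_. e)"
      by metis
    define p where "p j' = s j' l0" for j'
    have p: "(p j', w j') \<in> \<beta>" for j' using s(2)[OF I(2), of j'] unfolding p_def b_def by simp
    have p_tail: "p j' = w j'" if "m \<le> j'" for j'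
      unfolding p_def using s(4)[OF that] w_tail[OF that] by simp
    define h where "h y = f (\<phi> (p(j := y)))" for y
    \<comment> \<open>By the term condition, moving the other arguments from \<open>w\<close> to
      \<open>p\<close> does not change which values of argument \<open>j\<close> are identified
      modulo \<delta>.\<close>
    have gh: "(g j x, g j y) \<in> \<delta> \<longleftrightarrow> (h x, h y) \<in> \<delta>" if "(w j, x) \<in> \<beta>" "(w j, y) \<in> \<beta>" for x y
    proof -
      have "(x, y) \<in> \<beta>" using that equiv(1) by (meson equivE symE transE)
      then show ?thesis
        unfolding g_def h_def
        using centralizes_section_iff[OF cen equiv(1) fphi, of p w m x y j] p p_tail by blast
    qed
    have hA: "h y \<in> A" "g j y \<in> A" if "(w j, y) \<in> \<beta>" for y
      using A[OF that] A(1)[OF p] w unfolding h_def g_def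
      by (auto intro!: polys_closed[OF fphi])
    have "\<delta> `` {g j x} = \<delta> `` {g j y} \<longleftrightarrow> \<delta> `` {h x} = \<delta> `` {h y}"
      if "(w j, x) \<in> \<beta>" "(w j, y) \<in> \<beta>" for x y
      using gh[OF that] hA[OF that(1)] hA[OF that(2)] by (simp add: eq_equiv_class_iff[OF equiv(2)])
    \<comment> \<open>So \<open>h\<close> meets as many classes as \<open>g j\<close>, that is, as
      many as \<open>f\<close>. By \<open>sub\<close> they lie among those of \<open>f\<close>,
      hence \<open>h\<close> reaches the class of \<open>f (a l0)\<close>.\<close>
    then have "card (?im (g j) (w j)) = card (?im h (w j))"
      by (intro card_image_eq_if_same_kernel) auto
    then have "?im h (w j) = ?im f (a l0)"
      using j sub[of p j] p fin unfolding rank_def h_def by (intro card_subset_eq) auto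
    moreover have "\<delta> `` {f (a l0)} \<in> ?im f (a l0)" using refl a by blast
    ultimately have "\<delta> `` {f (a l0)} \<in> ?im h (w j)" by simp
    then obtain y where y: "(w j, y) \<in> \<beta>" "\<delta> `` {f (a l0)} = \<delta> `` {h y}" by blast
    then have hy: "(h y, f (a l0)) \<in> \<delta>"
      using eq_equiv_class_iff[OF equiv(2) hA(1)[OF y(1)] upolys_closed[OF f a[of l0]]] by simp
    \<comment> \<open>Away from \<open>l0\<close> the value \<open>c\<close> is exactly the entry of
      row \<open>i\<close> in column \<open>j\<close>, so the cube identity still holds there;
      \<open>y\<close> makes the correction at \<open>l0\<close>.\<close>
    define s' where "s' j' = (if j' = j then (\<lambda>_. c)(l0 := y) else s j')" for j'
    have s': "s' j' \<in> S" for j' unfolding s'_def using s(1) almost[OF i(2) A(2)[OF y(1)]] by simp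
    have l0: "(\<lambda>j'. s' j' l0) = p(j := y)" unfolding s'_def p_def by auto
    have other: "\<phi> (\<lambda>j'. b j' l) = a l" if "l \<noteq> l0" for l
      using phi_W[OF i(1) a] that unfolding b_def by simp
    have \<beta>: "(\<phi> (\<lambda>j'. s' j' l), a l) \<in> \<beta>" if "l \<in> L" for l
    proof (cases "l = l0")
      case True
      have "(\<phi> (p(j := y)), \<phi> w) \<in> \<beta>"
        using p y(1) equiv(1) by (intro polys_compat[OF phi_polys cong(1)]) (auto simp: equiv_def sym_def)
      then show ?thesis using True l0 phi_w by simp
    next
      case False
      have "(\<phi> (\<lambda>j'. s' j' l), \<phi> (\<lambda>j'. b j' l)) \<in> \<beta>"
        using s(2)[OF that] False i(3) refl[OF i(2)]
        by (intro polys_compat[OF phi_polys cong(1)]) (auto simp: s'_def b_def)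
      then show ?thesis using other[OF False] by simp
    qed
    have \<delta>: "(\<phi> (\<lambda>j'. s' j' l), a l) \<in> \<delta>" if "l \<in> I" for l
    proof -
      have "l \<noteq> l0" using that I by auto
      have "(\<phi> (\<lambda>j'. s' j' l), \<phi> (\<lambda>j'. b j' l)) \<in> \<delta>"
        using s(3)[OF that] \<open>l \<noteq> l0\<close> i(3) refl[OF i(2)]
        by (intro polys_compat[OF phi_polys cong(2)]) (auto simp: s'_def b_def)
      then show ?thesis using other[OF \<open>l \<noteq> l0\<close>] by simp
    qed
    show ?thesis
      using clos[of s', OF s'] \<beta> \<delta> hy unfolding h_def l0[symmetric]
      by (intro bexI[of _ "\<lambda>l. \<phi> (\<lambda>j'. s' j' l)"]) auto
  next
    case False
    then have less': "rank \<beta> \<delta> (g j) (w j) < rank \<beta> \<delta> f (a l0)" for j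
      using le[of j] by (simp add: nat_less_le)
    define b where "b j l = W 0 (a l) j" for j l
    have b: "b j l \<in> A" for j l unfolding b_def using W_closed[OF k] a by simp
    have bw: "b j l0 = w j" for j unfolding b_def w_def by simp
    have "\<exists>s\<in>S. (\<forall>l\<in>L. (s l, b j l) \<in> \<beta>) \<and> (\<forall>l\<in>I. (s l, b j l) \<in> \<delta>)
        \<and> (g j (s l0), g j (w j)) \<in> \<delta> \<and> (m \<le> j \<longrightarrow> s = (\<lambda>_. e))" for j
    proof (cases "m \<le> j")
      case True
      then have "b j l = e" for l unfolding b_def using row_tail by simp
      moreover have "(g j e, g j e) \<in> \<delta>" using refl upolys_closed[OF g e] by blast
      ultimately show ?thesis using const_e refl[OF e] w_tail[OF True]
        by (intro bexI[of _ "\<lambda>_. e"]) auto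
    next
      case False
      then show ?thesis using less.hyps[of "g j" "b j"] less'[of j] g b bw by auto
    qed
    then obtain s where s: "\<And>j. s j \<in> S" "\<And>j l. l \<in> L \<Longrightarrow> (s j l, b j l) \<in> \<beta>"
      "\<And>j l. l \<in> I \<Longrightarrow> (s j l, b j l) \<in> \<delta>" "\<And>j. (g j (s j l0), g j (w j)) \<in> \<delta>"
      "\<And>j. m \<le> j \<Longrightarrow> s j = (\<lambda>_. e)"
      by metis
    define p where "p j = s j l0" for j
    have p: "(p j, w j) \<in> \<beta>" for j using s(2)[OF I(2), of j] unfolding p_def bw .
    \<comment> \<open>The recursive calls control a change of one coordinate of \<open>w\<close> at
      a time. The term condition transfers the \<open>q\<close>-th change to \<open>v q\<close>,
      where the earlier coordinates have already been replaced.\<close>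
    define v where "v q j = (if j < q then p j else w j)" for q j
    have tele: "(f (\<phi> (v q)), f (\<phi> w)) \<in> \<delta>" for q
    proof (induction q)
      case 0
      have "v 0 = w" unfolding v_def by auto
      moreover have "f (\<phi> w) \<in> A" using phi_w upolys_closed[OF f a] by simp
      ultimately show ?case using refl by simp
    next
      case (Suc q)
      have "(f (\<phi> (w(q := p q))), f (\<phi> (w(q := w q)))) \<in> \<delta>"
        using s(4)[of q] unfolding g_def p_def .
      moreover have "(w j, v q j) \<in> \<beta>" for j
        using p[of j] refl[OF w] equiv(1) unfolding v_def by (auto simp: equiv_def sym_def)
      ultimately have "(f (\<phi> ((v q)(q := p q))), f (\<phi> ((v q)(q := w q)))) \<in> \<delta>"
        using p[of q] by (intro centralizes_section[OF cen equiv(1) fphi, of w "v q" q])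
          (auto simp: v_def)
      moreover have "(v q)(q := p q) = v (Suc q)" "(v q)(q := w q) = v q"
        unfolding v_def by (auto simp: less_Suc_eq)
      ultimately show ?case using Suc trans by simp
    qed
    have vm: "v m = p" unfolding v_def p_def using s(5) w_tail by auto
    have row0: "\<phi> (\<lambda>j. b j l) = a l" for l unfolding b_def using phi_W[OF k a] .
    have "(\<phi> (\<lambda>j. s j l), \<phi> (\<lambda>j. b j l)) \<in> \<beta>" if "l \<in> L" for l
      using s(2)[OF that] by (intro polys_compat[OF phi_polys cong(1)]) auto
    moreover have "(\<phi> (\<lambda>j. s j l), \<phi> (\<lambda>j. b j l)) \<in> \<delta>" if "l \<in> I" for l
      using s(3)[OF that] by (intro polys_compat[OF phi_polys cong(2)]) auto
    moreover have "(f (\<phi> (\<lambda>j. s j l0)), f (a l0)) \<in> \<delta>"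
      using tele[of m] unfolding vm phi_w p_def .
    ultimately show ?thesis
      using clos[of s, OF s(1)] unfolding row0
      by (intro bexI[of _ "\<lambda>l. \<phi> (\<lambda>j. s j l)"]) auto
  qed
qed

text \<open>The set \<open>I\<close> of corrected coordinates grows by
  \<open>extend_coordinate\<close> with the identity as \<open>f\<close>. The induction is over all
  tuples \<open>a\<close>, since each step applies the previous one to the arguments of
  \<phi>.\<close>

lemma extend_all:
  fixes S :: "(nat \<Rightarrow> 'a) set"
  assumes cong: "is_congruence A ops ar \<beta>" "is_congruence A ops ar \<delta>"
    and cen: "centralizes A ops ar \<beta> \<beta> \<delta>"
    and almost: "\<And>c y l. c \<in> A \<Longrightarrow> y \<in> A \<Longrightarrow> (\<lambda>_. c)(l := y) \<in> S"
    and clos: "\<And>s. (\<And>j. s j \<in> S) \<Longrightarrow> (\<lambda>l. \<phi> (\<lambda>j. s j l)) \<in> S"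
    and base: "\<And>a. (\<And>l. a l \<in> A) \<Longrightarrow> \<exists>s\<in>S. \<forall>l\<in>L. (s l, a l) \<in> \<beta>"
    and L: "finite L" and a: "\<And>l. a l \<in> A"
  shows "\<exists>s\<in>S. \<forall>l\<in>L. (s l, a l) \<in> \<delta>"
proof -
  have "\<exists>s\<in>S. (\<forall>l\<in>L. (s l, a l) \<in> \<beta>) \<and> (\<forall>l\<in>I. (s l, a l) \<in> \<delta>)"
    if "finite I" "I \<subseteq> L" "\<And>l. a l \<in> A" for I a
    using that
  proof (induction I arbitrary: a rule: finite_induct)
    case empty
    then show ?case using base by simp
  next
    case (insert l0 I)
    have "\<exists>s\<in>S. (\<forall>l\<in>L. (s l, a l) \<in> \<beta>) \<and> (\<forall>l\<in>I. (s l, a l) \<in> \<delta>) \<and> (s l0, a l0) \<in> \<delta>"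
      using insert
      by (intro extend_coordinate[OF cong cen almost clos _ _ _ upolys_id]) auto
    then show ?case by auto
  qed
  then show ?thesis using L a by blast
qed

lemma generated_by_almost_constant:
  assumes "solvable_alg A ops ar"
  shows "generates_power A ops ar n (almost_constant A n)"
proof -
  let ?X = "almost_constant A n"
  \<comment> \<open>Functions on all naturals stand for tuples; their values from \<open>n\<close>
    on are ignored.\<close>
  define S where "S = {u. map u [0..<n] \<in> gen_sub ops ar n ?X}"
  have almost: "(\<lambda>_. c)(l := y) \<in> S" if "c \<in> A" "y \<in> A" for c y l
    unfolding S_def using gen_sub.base[OF almost_constant_upd[OF that]] by simp
  have clos: "(\<lambda>l. \<phi> (\<lambda>j. s j l)) \<in> S" if "\<And>j. s j \<in> S" for s
    using that gen_sub_eval_trm[OF F, of s] unfolding S_def \<phi>_def by simp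
  have reach: "\<exists>s\<in>S. \<forall>l\<in>{..<n}. (s l, a l) \<in> derived_cong A ops ar j" if "\<And>l. a l \<in> A" for j a
    using that
  proof (induction j arbitrary: a)
    case 0
    then show ?case using e almost[OF e e, of 0] by (intro bexI[of _ "(\<lambda>_. e)(0 := e)"]) auto
  next
    case (Suc j)
    let ?\<beta> = "derived_cong A ops ar j"
    note props = commutator_props[OF derived_congruence[of j]]
    show ?case unfolding derived_cong.simps
      by (rule extend_all[OF derived_congruence[of j] props(1,2) almost clos Suc.IH])
        (use Suc.prems in auto)
  qed
  obtain j where j: "derived_cong A ops ar j = Id_on A"
    using assms unfolding solvable_alg_def by blast
  have X: "?X \<subseteq> power_carrier A n" unfolding almost_constant_def by blast
  moreover have "power_carrier A n \<subseteq> gen_sub ops ar n ?X"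
  proof
    fix v assume v: "v \<in> power_carrier A n"
    define a where "a l = (if l < n then v ! l else e)" for l
    have "a l \<in> A" for l using v e unfolding a_def power_carrier_def by auto
    from reach[of a j, OF this] obtain s where s: "s \<in> S" "\<forall>l\<in>{..<n}. (s l, a l) \<in> Id_on A"
      unfolding j by blast
    have "map s [0..<n] = v"
      using v s(2) unfolding a_def power_carrier_def by (auto intro!: nth_equalityI simp: Id_on_iff)
    then show "v \<in> gen_sub ops ar n ?X" using s(1) unfolding S_def by simp
  qed
  ultimately show ?thesis
    unfolding generates_power_def using gen_sub_closed[OF X] by blast
qed

section \<open>The lower bound\<close>

text \<open>\<psi> acts as a difference, with \<open>e\<close> as zero. A column \<open>j\<close>
  that tells \<open>p\<close> from \<open>q\<close> modulo \<delta> is varied in a row where its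
  entry is constant; this gives \<open>B\<close>, and \<psi> sends \<open>(x, y)\<close> to
  \<open>B y (D x)\<close>.\<close>

lemma separating_polynomial:
  assumes cong: "is_congruence A ops ar \<delta>" and cen: "centralizes A ops ar (A \<times> A) (A \<times> A) \<delta>"
    and pq: "p \<in> A" "q \<in> A" "(p, q) \<notin> \<delta>"
  shows "\<exists>\<psi>\<in>polys. \<exists>z. (\<forall>x\<in>A. (\<psi> (\<lambda>_. x), z) \<in> \<delta>) \<and> (\<psi> (\<lambda>i. if i = 0 then p else q), z) \<notin> \<delta>"
proof -
  have equiv: "equiv A \<delta>" "equiv A (A \<times> A)"
    using cong congruence_full unfolding is_congruence_def by auto
  have refl: "(x, x) \<in> \<delta>" if "x \<in> A" for x
    using equiv(1) that unfolding equiv_def refl_on_def by auto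
  have trans: "(x, z) \<in> \<delta>" if "(x, y) \<in> \<delta>" "(y, z) \<in> \<delta>" for x y z
    using equiv(1) that by (meson equivE transD)
  have sym: "(y, x) \<in> \<delta>" if "(x, y) \<in> \<delta>" for x y
    using equiv(1) that by (meson equivE symD)
  define v where "v r j = (if j < r then W 0 q j else W 0 p j)" for r j
  have v: "v r j \<in> A" for r j unfolding v_def using W_closed[OF k] pq by simp
  have v_tail: "v r j = e" if "m \<le> j" for r j unfolding v_def using row_tail that by simp
  \<comment> \<open>Changing row 0 from \<open>p\<close> to \<open>q\<close> entry by entry changes
    the value of \<phi> from \<open>p\<close> to \<open>q\<close>, so some single change leaves the
    \<delta>-class.\<close>
  have "\<exists>j. (\<phi> ((v j)(j := W 0 p j)), \<phi> ((v j)(j := W 0 q j))) \<notin> \<delta>"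
  proof (rule ccontr)
    assume "\<not> ?thesis"
    moreover have "(v j)(j := W 0 p j) = v j" "(v j)(j := W 0 q j) = v (Suc j)" for j
      unfolding v_def by (auto simp: less_Suc_eq)
    ultimately have step: "(\<phi> (v j), \<phi> (v (Suc j))) \<in> \<delta>" for j by simp
    have "(\<phi> (v 0), \<phi> (v r)) \<in> \<delta>" for r
    proof (induction r)
      case 0
      show ?case using refl polys_closed[OF phi_polys v] .
    qed (rule trans[OF _ step])
    moreover have "v 0 = W 0 p" unfolding v_def by auto
    moreover have "v m = W 0 q" unfolding v_def using row_tail by (auto simp: fun_eq_iff)
    ultimately show False using phi_W[OF k] pq by metis
  qed
  then obtain j where j: "(\<phi> ((v j)(j := W 0 p j)), \<phi> ((v j)(j := W 0 q j))) \<notin> \<delta>" by blast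
  have "\<forall>x. W 0 x j = x"
  proof (rule ccontr)
    assume "\<not> ?thesis"
    then have "W 0 p j = W 0 q j" using row_entry[OF k, of j] by auto
    moreover have "\<phi> ((v j)(j := W 0 q j)) \<in> A"
      using v W_closed[OF k pq(2)] by (intro polys_closed[OF phi_polys]) auto
    ultimately show False using j refl by simp
  qed
  then have sep: "(\<phi> ((v j)(j := p)), \<phi> ((v j)(j := q))) \<notin> \<delta>" using j by simp
  obtain i c where i: "i < k" "c \<in> A" "\<And>x. W i x j = c" using column[of j] by blast
  text \<open>\<open>B c\<close> is the identity, so by the term condition each \<open>B y\<close> permutes the \<open>\<delta>\<close>-classes;
    \<open>D y\<close> solves \<open>B y (D y) = e\<close> modulo \<open>\<delta>\<close>.\<close>
  define B where "B y x = \<phi> ((W i x)(j := y))" for y x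
  have B_polys: "(\<lambda>u. B (\<eta> u) (\<chi> u)) \<in> polys" if "\<eta> \<in> polys" "\<chi> \<in> polys" for \<eta> \<chi>
  proof -
    have W: "(\<lambda>u. W i (\<chi> u) l) \<in> polys" for l
      using row_entry[OF i(1), of l] that(2) polys.const by auto
    define \<psi> :: "nat \<Rightarrow> (nat \<Rightarrow> 'a) \<Rightarrow> 'a"
      where "\<psi> l = (if l = j then \<eta> else (\<lambda>u. W i (\<chi> u) l))" for l
    have "(\<lambda>u. \<phi> (\<lambda>l. \<psi> l u)) \<in> polys"
      using W that(1) by (intro polys_comp[OF phi_polys]) (simp add: \<psi>_def)
    moreover have "(\<lambda>l. \<psi> l u) = (W i (\<chi> u))(j := \<eta> u)" for u
      unfolding \<psi>_def by auto
    ultimately show ?thesis unfolding B_def by simp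
  qed
  have B_closed: "B y x \<in> A" if "y \<in> A" "x \<in> A" for x y
    unfolding B_def using W_closed[OF i(1)] that by (intro polys_closed[OF phi_polys]) auto
  have "(W i x)(j := c) = W i x" for x using i(3)[of x] by auto
  then have Bc: "B c x = x" if "x \<in> A" for x
    unfolding B_def using phi_W[OF i(1) that] by simp
  \<comment> \<open>The term condition moves the parameter \<open>y\<close> to \<open>c\<close>,
    where \<open>B c\<close> is the identity.\<close>
  have B_ker: "(B y x, B y x') \<in> \<delta> \<longleftrightarrow> (x, x') \<in> \<delta>" if "y \<in> A" "x \<in> A" "x' \<in> A" for x x' y
  proof -
    have "(\<lambda>u. B (u 1) (u 0)) \<in> polys" by (intro B_polys polys.proj)
    from centralizes_section_iff[OF cen equiv(2) this, of "\<lambda>_. c" "(\<lambda>_. c)(1 := y)" 2 x x' 0]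
    show ?thesis using that i(2) Bc by simp
  qed
  \<comment> \<open>The separation found at \<open>v j\<close> is carried over to row
    \<open>i\<close> by the term condition.\<close>
  have B_sep: "(B p x, B q x) \<notin> \<delta>" if "x \<in> A" for x
    using centralizes_section_iff[OF cen equiv(2) phi_polys, of "v j" "W i x" m p q j]
      sep v W_closed[OF i(1) that] pq row_tail v_tail unfolding B_def by auto
  \<comment> \<open>Since \<open>N\<close> does not depend on \<open>y\<close>, the solution
    \<open>D y\<close> is a polynomial in \<open>y\<close>.\<close>
  define N :: nat where "N = fact (card A)"
  have iter: "((B y ^^ N) x, x) \<in> \<delta>" if "y \<in> A" "x \<in> A" for x y
    unfolding N_def using that by (intro iterate_fact_card[OF equiv(1)] B_closed B_ker) auto
  define D where "D y = (B y ^^ (N - 1)) e" for y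
  have D: "D y \<in> A" if "y \<in> A" for y
  proof -
    have "(B y ^^ r) e \<in> A" for r by (induction r) (auto intro: B_closed that e)
    then show ?thesis unfolding D_def .
  qed
  have "Suc (N - 1) = N" unfolding N_def by simp
  then have BD: "(B y (D y), e) \<in> \<delta>" if "y \<in> A" for y
    unfolding D_def using iter[OF that e] by (metis funpow.simps(2) o_apply)
  have D_polys: "(\<lambda>u. D (u 0)) \<in> polys"
  proof -
    have "(\<lambda>u. (B (u 0) ^^ r) e) \<in> polys" for r
      by (induction r) (auto intro: B_polys polys.proj polys.const e)
    then show ?thesis unfolding D_def .
  qed
  define \<psi> where "\<psi> u = B (u 1) (D (u (0::nat)))" for u
  have "\<psi> \<in> polys" unfolding \<psi>_def by (intro B_polys D_polys polys.proj)
  moreover have "(\<psi> (\<lambda>_. x), e) \<in> \<delta>" if "x \<in> A" for x unfolding \<psi>_def using BD[OF that] .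
  moreover have "(B q (D p), e) \<notin> \<delta>"
    using trans[OF BD[OF pq(1)] sym] B_sep[OF D[OF pq(1)]] by blast
  then have "(\<psi> (\<lambda>i. if i = 0 then p else q), e) \<notin> \<delta>" unfolding \<psi>_def by simp
  ultimately show ?thesis by blast
qed

text \<open>The difference \<chi> of \<open>t\<close> and \<open>t'\<close> lies in the class of
  \<open>z\<close> on all axes. Coordinates of \<open>u\<close> are switched on one at a time, and
  by the term condition each switch is as harmless as on its axis, so \<chi> stays in that
  class.\<close>

lemma polys_eq_if_eq_on_axes:
  assumes cong: "is_congruence A ops ar \<delta>" and cen: "centralizes A ops ar (A \<times> A) (A \<times> A) \<delta>"
    and t: "t \<in> polys" "t' \<in> polys"
    and axes: "\<And>r x. r \<le> s \<Longrightarrow> x \<in> A \<Longrightarrow> t ((\<lambda>_. e)(r := x)) = t' ((\<lambda>_. e)(r := x))"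
    and u: "\<And>i. u i \<in> A" "\<And>i. s \<le> i \<Longrightarrow> u i = e"
  shows "(t u, t' u) \<in> \<delta>"
proof (rule ccontr)
  assume "(t u, t' u) \<notin> \<delta>"
  moreover have "t u \<in> A" "t' u \<in> A" using polys_closed t u by auto
  ultimately obtain \<psi> z where \<psi>: "\<psi> \<in> polys" "\<And>x. x \<in> A \<Longrightarrow> (\<psi> (\<lambda>_. x), z) \<in> \<delta>"
    "(\<psi> (\<lambda>i. if i = 0 then t u else t' u), z) \<notin> \<delta>"
    using separating_polynomial[OF cong cen] by blast
  have equiv: "equiv A \<delta>" "equiv A (A \<times> A)"
    using cong congruence_full unfolding is_congruence_def by auto
  define \<chi> where "\<chi> u = \<psi> (\<lambda>i. if i = 0 then t u else t' u)" for u
  have "(\<lambda>u. \<psi> (\<lambda>i. (if i = 0 then t else t') u)) \<in> polys"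
    using t by (intro polys_comp[OF \<psi>(1)]) simp
  then have \<chi>: "\<chi> \<in> polys" unfolding \<chi>_def by (simp add: if_distribR)
  have axis: "(\<chi> ((\<lambda>_. e)(r := x)), z) \<in> \<delta>" if "r \<le> s" "x \<in> A" for r x
  proof -
    have "t' ((\<lambda>_. e)(r := x)) \<in> A" using e that(2) by (intro polys_closed[OF t(2)]) auto
    then show ?thesis unfolding \<chi>_def axes[OF that] if_cancel by (rule \<psi>(2))
  qed
  define v where "v r j = (if j < r then u j else e)" for r and j :: nat
  have "(\<chi> (v r), z) \<in> \<delta>" if "r \<le> s" for r
    using that
  proof (induction r)
    case 0
    \<comment> \<open>The axes run over \<open>r \<le> s\<close>, so axis 0 is available even for
      \<open>s = 0\<close>.\<close>
    have "v 0 = (\<lambda>_. e)(0 := e)" unfolding v_def by auto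
    then show ?case by (simp only: axis e le0)
  next
    case (Suc r)
    have "(\<chi> ((\<lambda>_. e)(r := u r)), \<chi> ((\<lambda>_. e)(r := e))) \<in> \<delta>"
      using axis[of r] Suc.prems u(1) e equiv(1) by (meson Suc_leD equivE symE transE)
    then have "(\<chi> ((v r)(r := u r)), \<chi> ((v r)(r := e))) \<in> \<delta>"
      using u(1) e by (intro centralizes_section[OF cen equiv(2) \<chi>, of "\<lambda>_. e" "v r" r])
        (auto simp: v_def)
    moreover have "(v r)(r := u r) = v (Suc r)" "(v r)(r := e) = v r"
      unfolding v_def by (auto simp: less_Suc_eq)
    ultimately show ?case using Suc equiv(1) by (metis Suc_leD equivE transD)
  qed
  moreover have "v s = u" unfolding v_def using u(2) by (auto simp: fun_eq_iff not_less)
  ultimately show False using \<psi>(3) unfolding \<chi>_def by (metis order_refl)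
qed

end

lemma gen_sub_imp_trm:
  assumes "v \<in> gen_sub ops ar n (g ` {..<s})" "\<And>i. i < s \<Longrightarrow> length (g i) = n"
  shows "\<exists>t. wf_trm ar t \<and> v = map (\<lambda>l. eval_trm ops t (\<lambda>i. if i < s then g i ! l else z)) [0..<n]"
  using assms(1)
proof induction
  case (base x)
  then obtain i where "i < s" "x = g i" by auto
  then show ?case using assms(2) by (intro exI[of _ "Var i"]) (auto intro: nth_equalityI)
next
  case (step vs f)
  then have "\<forall>v\<in>set vs. \<exists>t. wf_trm ar t \<and>
      v = map (\<lambda>l. eval_trm ops t (\<lambda>i. if i < s then g i ! l else z)) [0..<n]"
    by blast
  from bchoice[OF this] obtain T where T: "\<And>v. v \<in> set vs \<Longrightarrow> wf_trm ar (T v)"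
    "\<And>v. v \<in> set vs \<Longrightarrow> v = map (\<lambda>l. eval_trm ops (T v) (\<lambda>i. if i < s then g i ! l else z)) [0..<n]"
    by blast
  have "v ! l = eval_trm ops (T v) (\<lambda>i. if i < s then g i ! l else z)" if "v \<in> set vs" "l < n" for v l
    using arg_cong[OF T(2)[OF that(1)], of "\<lambda>v. v ! l"] that(2) by (simp cong: if_cong)
  then have "ops f (map (\<lambda>v. v ! l) vs)
      = eval_trm ops (Fun f (map T vs)) (\<lambda>i. if i < s then g i ! l else z)" if "l < n" for l
    unfolding eval_trm.simps map_map o_def using that by (intro arg_cong[where f = "ops f"] map_cong refl)
  moreover have "wf_trm ar (Fun f (map T vs))" using T(1) step(1) by auto
  ultimately show ?case by (intro exI[of _ "Fun f (map T vs)"] conjI map_cong) auto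
qed

lemma (in cube_algebra) card_generators_ge:
  assumes cong: "is_congruence A ops ar \<delta>" and cen: "centralizes A ops ar (A \<times> A) (A \<times> A) \<delta>"
    and pq: "p \<in> A" "q \<in> A" "(p, q) \<notin> \<delta>"
    and X: "generates_power A ops ar n X" "finite X"
  shows "n \<le> (card X + 1) * (card A)\<^sup>2"
proof -
  define s where "s = card X"
  have equiv: "equiv A \<delta>" using cong unfolding is_congruence_def by auto
  obtain g where g: "g ` {..<s} = X"
    using ex_bij_betw_nat_finite[OF X(2)] unfolding s_def bij_betw_def atLeast0LessThan by blast
  have gX: "g i \<in> power_carrier A n" if "i < s" for i
    using g X(1) that unfolding generates_power_def by blast
  define env where "env l i = (if i < s then g i ! l else e)" for l i
  have env: "env l i \<in> A" if "l < n" for l i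
    using gX[of i] that e by (auto simp: env_def power_carrier_def subset_iff)
  define V where "V = {vs. set vs \<subseteq> {p, q} \<and> length vs = n}"
  have "\<exists>t. wf_trm ar t \<and> v = map (\<lambda>l. eval_trm ops t (env l)) [0..<n]" if "v \<in> V" for v
  proof -
    have "v \<in> gen_sub ops ar n (g ` {..<s})"
      using that pq X(1) unfolding V_def generates_power_def power_carrier_def g by blast
    then show ?thesis
      unfolding env_def using gX by (intro gen_sub_imp_trm) (auto simp: power_carrier_def)
  qed
  then obtain T where T: "\<And>v. v \<in> V \<Longrightarrow> wf_trm ar (T v)"
    "\<And>v. v \<in> V \<Longrightarrow> v = map (\<lambda>l. eval_trm ops (T v) (env l)) [0..<n]"
    by metis
  \<comment> \<open>The record of a term on the axes. Equal records give tuples that agree modulo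
    \<delta> everywhere, and over \<open>{p, q}\<close> this is equality.\<close>
  define \<Phi> where "\<Phi> v = (\<lambda>(r, x)\<in>{..s} \<times> A. eval_trm ops (T v) ((\<lambda>_. e)(r := x)))" for v
  have "inj_on \<Phi> V"
  proof (rule inj_onI)
    fix v v' assume v: "v \<in> V" "v' \<in> V" and eq: "\<Phi> v = \<Phi> v'"
    have axes: "eval_trm ops (T v) ((\<lambda>_. e)(r := x)) = eval_trm ops (T v') ((\<lambda>_. e)(r := x))"
      if "r \<le> s" "x \<in> A" for r x
      using fun_cong[OF eq, of "(r, x)"] that unfolding \<Phi>_def by simp
    show "v = v'"
    proof (rule nth_equalityI)
      show "length v = length v'" using v unfolding V_def by simp
      fix l assume "l < length v"
      then have l: "l < n" "v ! l \<in> {p, q}" "v' ! l \<in> {p, q}"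
        using v nth_mem[of l v] nth_mem[of l v'] unfolding V_def by (auto simp del: nth_mem)
      have "(eval_trm ops (T v) (env l), eval_trm ops (T v') (env l)) \<in> \<delta>"
        using env[OF l(1)] by (intro polys_eq_if_eq_on_axes[OF cong cen
            eval_polys[OF T(1)[OF v(1)]] eval_polys[OF T(1)[OF v(2)]] axes]) (auto simp: env_def)
      moreover have "v ! l = eval_trm ops (T v) (env l)" "v' ! l = eval_trm ops (T v') (env l)"
        using arg_cong[OF T(2)[OF v(1)], of "\<lambda>v. v ! l"] arg_cong[OF T(2)[OF v(2)], of "\<lambda>v. v ! l"]
          l(1) by simp_all
      ultimately have "(v ! l, v' ! l) \<in> \<delta>" by simp
      then show "v ! l = v' ! l" using l(2,3) pq(3) equiv by (auto elim!: equivE dest: symD)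
    qed
  qed
  moreover have "\<Phi> ` V \<subseteq> {..s} \<times> A \<rightarrow>\<^sub>E A"
    using T(1) e unfolding \<Phi>_def
    by (auto intro!: polys_closed[OF eval_polys] simp: PiE_def extensional_def)
  moreover have "finite ({..s} \<times> A \<rightarrow>\<^sub>E A)"
    using finite_carrier by (intro finite_PiE) auto
  ultimately have "card V \<le> card ({..s} \<times> A \<rightarrow>\<^sub>E A)" by (rule card_inj_on_le)
  moreover have "p \<noteq> q" using pq equiv unfolding equiv_def refl_on_def by blast
  then have "card V = 2 ^ n" unfolding V_def by (subst card_lists_length_eq) (auto simp: numeral_2_eq_2)
  moreover have "card ({..s} \<times> A \<rightarrow>\<^sub>E A) = card A ^ ((s + 1) * card A)"
    using finite_carrier by (subst card_funcsetE) (auto simp: card_cartesian_product)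
  ultimately have "2 ^ n \<le> card A ^ ((s + 1) * card A)" by simp
  \<comment> \<open>The crude bound \<open>card A \<le> 2 ^ card A\<close> makes both sides powers
    of 2, whose exponents can be compared.\<close>
  also have "\<dots> \<le> (2 ^ card A) ^ ((s + 1) * card A)"
    by (intro power_mono) auto
  also have "\<dots> = 2 ^ ((s + 1) * (card A)\<^sup>2)"
    by (simp add: power2_eq_square algebra_simps flip: power_mult)
  finally show ?thesis unfolding s_def by simp
qed

section \<open>Counting almost constant tuples, and the final assembly\<close>

lemma card_almost_constant_le:
  assumes "finite A" "A \<noteq> {}" "0 < n"
  shows "finite (almost_constant A n)" "card (almost_constant A n) \<le> n * (card A)\<^sup>2"
proof -
  let ?f = "\<lambda>(j, c, y). map ((\<lambda>_. c)(j := y)) [0..<n]"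
  let ?D = "{..<n} \<times> A \<times> A"
  have sub: "almost_constant A n \<subseteq> ?f ` ?D"
  proof
    fix xs assume "xs \<in> almost_constant A n"
    then obtain j c where xs: "length xs = n" "set xs \<subseteq> A" and c: "\<And>i. i < n \<Longrightarrow> i \<noteq> j \<Longrightarrow> xs ! i = c"
      unfolding almost_constant_def power_carrier_def by blast
    have nth: "xs ! i \<in> A" if "i < n" for i using xs that by auto
    \<comment> \<open>The position \<open>j\<close> may lie outside the tuple, and for
      \<open>n = 1\<close> nothing forces \<open>c\<close> into \<open>A\<close>; both are replaced
      by admissible values.\<close>
    define j' where "j' = (if j < n then j else 0)"
    define c' where "c' = (if c \<in> A then c else xs ! 0)"
    have "xs ! i = c'" if "i < n" "i \<noteq> j'" for i
      using c[of i] nth[of i] that unfolding c'_def j'_def by (auto split: if_splits)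
    then have "xs = ?f (j', c', xs ! j')"
      using xs by (auto intro!: nth_equalityI)
    moreover have "(j', c', xs ! j') \<in> ?D"
      using nth assms(3) unfolding j'_def c'_def by auto
    ultimately show "xs \<in> ?f ` ?D" by blast
  qed
  have fin: "finite ?D" using assms(1) by simp
  show "finite (almost_constant A n)" using sub fin finite_surj by blast
  have "card (almost_constant A n) \<le> card ?D" using sub fin by (rule surj_card_le[rotated])
  then show "card (almost_constant A n) \<le> n * (card A)\<^sup>2"
    by (simp add: card_cartesian_product power2_eq_square)
qed

text \<open>Setting all variables but \<open>x\<close> to \<open>e\<close> keeps the identities and
  turns every symbol other than \<open>x\<close> into a constant.\<close>

lemma (in finite_algebra) cube_algebra_if_pointed_cube_term:
  assumes "has_pointed_cube_term A ops ar"
  obtains k m F e W where "cube_algebra A ops ar k m F e W"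
proof -
  obtain k m :: nat and F and M :: "nat \<Rightarrow> nat \<Rightarrow> nat + 'a"
    where k: "0 < k" and F: "wf_trm ar F" "trm_vars F \<subseteq> {..<m}"
    and M: "\<forall>i<k. \<forall>j<m. \<forall>a. M i j = Inr a \<longrightarrow> a \<in> A" "\<forall>j<m. \<exists>i<k. M i j \<noteq> Inl 0"
    and id: "\<forall>env. (\<forall>v. env v \<in> A) \<longrightarrow>
      (\<forall>i<k. eval_trm ops F (\<lambda>j. case M i j of Inl v \<Rightarrow> env v | Inr a \<Rightarrow> a) = env 0)"
    using assms unfolding has_pointed_cube_term_def by (elim exE conjE) (rule that; assumption)
  obtain e where e: "e \<in> A" using algebra unfolding is_algebra_def by blast
  \<comment> \<open>Padding with \<open>e\<close> from \<open>m\<close> on makes any two rows differ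
    in finitely many places only.\<close>
  define W where "W i x j = (if j < m then
      (case M i j of Inl v \<Rightarrow> if v = 0 then x else e | Inr a \<Rightarrow> a) else e)" for i x j
  have "cube_algebra A ops ar k m F e W"
  proof
    fix i x assume i: "i < k" "x \<in> A"
    have "eval_trm ops F (W i x) = eval_trm ops F (\<lambda>j. case M i j of Inl v \<Rightarrow> ((\<lambda>_. e)(0 := x)) v | Inr a \<Rightarrow> a)"
      using F(2) by (intro eval_trm_cong) (auto simp: W_def split: sum.split)
    also have "\<dots> = x" using id[rule_format, of "(\<lambda>_. e)(0 := x)" i] i e by simp
    finally show "eval_trm ops F (W i x) = x" .
  next
    fix i j assume "i < k"
    then show "(\<forall>x. W i x j = x) \<or> (\<exists>c\<in>A. \<forall>x. W i x j = c)"
      unfolding W_def using e M(1)[rule_format, of i j] by (cases "M i j") auto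
  next
    fix j
    show "\<exists>i<k. \<exists>c\<in>A. \<forall>x. W i x j = c"
    proof (cases "j < m")
      case True
      then obtain i where "i < k" "M i j \<noteq> Inl 0" using M(2) by blast
      then show ?thesis
        unfolding W_def using e M(1)[rule_format, of i j] by (intro exI[of _ i]) (cases "M i j"; auto)
    qed (use e k in \<open>auto simp: W_def\<close>)
  qed (use k F(1) e in \<open>auto simp: W_def\<close>)
  then show ?thesis by (rule that)
qed

theorem theorem4p1:
  fixes A :: "'a set" and ops :: "'f \<Rightarrow> 'a list \<Rightarrow> 'a" and ar :: "'f \<Rightarrow> nat"
  assumes "is_algebra A ops ar"
    and "finite A" and "2 \<le> card A"
    and "solvable_alg A ops ar"
    and "has_pointed_cube_term A ops ar"
  shows "(\<lambda>n. real (d_gen A ops ar n)) \<in> \<Theta>(\<lambda>n. real n)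
         \<and> (\<forall>n. generates_power A ops ar n (almost_constant A n))"
proof -
  interpret finite_algebra A ops ar by standard (use assms in auto)
  obtain k m F e W where "cube_algebra A ops ar k m F e W"
    using cube_algebra_if_pointed_cube_term[OF assms(5)] .
  then interpret cube_algebra A ops ar k m F e W .
  have gen: "generates_power A ops ar n (almost_constant A n)" for n
    using generated_by_almost_constant[OF assms(4)] .
  define \<delta> where "\<delta> = derived_cong A ops ar 1"
  have cong: "is_congruence A ops ar \<delta>"
    unfolding \<delta>_def by (rule derived_congruence)
  have cen: "centralizes A ops ar (A \<times> A) (A \<times> A) \<delta>"
    unfolding \<delta>_def using commutator_props(2)[OF congruence_full] by simp
  \<comment> \<open>If the first commutator were everything, the derived series would never leave
    \<open>A \<times> A\<close>, and solvability would force \<open>A\<close> to have one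
    element.\<close>
  have "\<exists>p\<in>A. \<exists>q\<in>A. (p, q) \<notin> \<delta>"
  proof (rule ccontr)
    assume "\<not> ?thesis"
    moreover have "\<delta> \<subseteq> A \<times> A"
      unfolding \<delta>_def using commutator_props(3)[OF congruence_full] by simp
    ultimately have full: "tc_commutator A ops ar (A \<times> A) (A \<times> A) = A \<times> A"
      unfolding \<delta>_def by auto
    have "derived_cong A ops ar j = A \<times> A" for j
      by (induction j) (simp_all add: full)
    then have "A \<times> A = Id_on A" using assms(4) unfolding solvable_alg_def by auto
    then have "x = y" if "x \<in> A" "y \<in> A" for x y using that by blast
    then have "card A \<le> Suc 0" using assms(2) by (simp add: card_le_Suc0_iff_eq)
    then show False using assms(3) by simp
  qed
  then obtain p q where pq: "p \<in> A" "q \<in> A" "(p, q) \<notin> \<delta>" by blast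
  let ?C = "(card A)\<^sup>2"
  have fin: "finite (almost_constant A n)" "card (almost_constant A n) \<le> n * ?C" if "0 < n" for n
    using card_almost_constant_le[OF assms(2) _ that] e by auto
  have upper: "d_gen A ops ar n \<le> n * ?C" if "0 < n" for n
  proof -
    have "d_gen A ops ar n \<le> card (almost_constant A n)"
      unfolding d_gen_def using gen fin(1)[OF that] by (intro Least_le) blast
    then show ?thesis using fin(2)[OF that] by simp
  qed
  have lower: "n \<le> (d_gen A ops ar n + 1) * ?C" if "0 < n" for n
  proof -
    have "\<exists>X. generates_power A ops ar n X \<and> finite X \<and> card X = d_gen A ops ar n"
      unfolding d_gen_def
      by (rule LeastI_ex[of "\<lambda>s. \<exists>X. generates_power A ops ar n X \<and> finite X \<and> card X = s"])
        (use gen fin(1)[OF that] in blast)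
    then show ?thesis using card_generators_ge[OF cong cen pq] by metis
  qed
  have lower': "n \<le> 2 * ?C * d_gen A ops ar n" if "?C < n" for n
  proof -
    \<comment> \<open>With no generators \<open>lower\<close> would give \<open>n \<le> ?C\<close>.
      So there is at least one, and doubling absorbs the summand 1.\<close>
    have "d_gen A ops ar n \<noteq> 0" using lower[of n] that by (intro notI) simp
    then have "(d_gen A ops ar n + 1) * ?C \<le> (2 * d_gen A ops ar n) * ?C"
      by (intro mult_le_mono1) simp
    moreover have "n \<le> (d_gen A ops ar n + 1) * ?C" using lower that by simp
    ultimately have "n \<le> (2 * d_gen A ops ar n) * ?C" by linarith
    then show ?thesis by (simp add: ac_simps)
  qed
  have "(\<lambda>n. real (d_gen A ops ar n)) \<in> O(\<lambda>n. real n)"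
  proof (rule bigoI)
    show "\<forall>\<^sub>F n in sequentially. norm (real (d_gen A ops ar n)) \<le> real ?C * norm (real n)"
      using eventually_gt_at_top[of 0]
    proof eventually_elim
      case (elim n)
      then have "real (d_gen A ops ar n) \<le> real (n * ?C)" using upper of_nat_le_iff by blast
      then show ?case by (simp add: mult.commute)
    qed
  qed
  moreover have "(\<lambda>n. real (d_gen A ops ar n)) \<in> \<Omega>(\<lambda>n. real n)"
    unfolding bigomega_iff_bigo
  proof (rule bigoI)
    show "\<forall>\<^sub>F n in sequentially. norm (real n) \<le> real (2 * ?C) * norm (real (d_gen A ops ar n))"
      using eventually_gt_at_top[of ?C]
    proof eventually_elim
      case (elim n)
      then have "real n \<le> real (2 * ?C * d_gen A ops ar n)" using lower' of_nat_le_iff by blast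
      then show ?case by simp
    qed
  qed
  ultimately show ?thesis using gen by auto
qed

end
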